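(* Let $X$ and $Y$ be path-connected topological spaces which both have the discrete monodromy property. If $f:X\rightarrow Y$ is a homotopy equivalence with homotopy inverse $g:Y\rightarrow X$, then $f$ maps $w(X)$ homeomorphically onto $w(Y)$, with inverse $g|_{w(Y)}$.
   Context: $w(X)=\{x\in X\mid X\text{ is not semilocally simply connected at }x\}$, where $X$ is semilocally simply connected at $x$ if there is an open neighborhood $U$ of $x$ such that the inclusion-induced homomorphism $\pi_1(U,x)\rightarrow\pi_1(X,x)$ is trivial. Discrete monodromy property: let $X$ be a path-connected space with basepoint $x_0$. Let $\widetilde{X}$ be the set of path-homotopy classes $[\alpha]$ (rel. endpoints) of paths $\alpha:([0,1],0)\rightarrow(X,x_0)$, with the topology generated by basis elements $\langle\alpha,U\rangle=\{[\alpha\cdot\gamma]\mid\gamma:([0,1],0)\rightarrow(U,\alpha(1))\}$, where $U\subseteq X$ is open and $\alpha(1)\in U$; let $p:\widetilde{X}\rightarrow X$, $p([\alpha])=\alpha(1)$. For a path $\beta:[0,1]\rightarrow X$ from $x$ to $y$, the monodromy $\Phi_\beta:p^{-1}(x)\rightarrow p^{-1}(y)$ is $\Phi_\beta([\alpha])=[\alpha\cdot\beta]$. The space $X$ has the discrete monodromy property if for all $x,y\in X$ and every path $\beta$ in $X$ from $x$ to $y$, $\Phi_\beta$ is either the identity function or its graph is a discrete subset of $p^{-1}(x)\times p^{-1}(y)\subseteq\widetilde{X}\times\widetilde{X}$. *)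

theory Defs
  imports "HOL-Analysis.Analysis"
begin

text \<open>
  A space is a subset X of a type of class \<^class>\<open>topological_space\<close>, with the subspace
  topology.
\<close>

definition paths_from :: "'a::topological_space set \<Rightarrow> 'a \<Rightarrow> (real \<Rightarrow> 'a) set" where
  "paths_from X x = {\<alpha>. path \<alpha> \<and> path_image \<alpha> \<subseteq> X \<and> pathstart \<alpha> = x}"

definition path_class :: "'a::topological_space set \<Rightarrow> (real \<Rightarrow> 'a) \<Rightarrow> (real \<Rightarrow> 'a) set" where
  "path_class X \<alpha> = {\<alpha>'. homotopic_paths X \<alpha> \<alpha>'}"

text \<open>
  The homomorphism from the fundamental group of U to that of X induced by the inclusion sends
  the class of a loop in U to the class of the same loop in X. It is trivial iff the latter is
  always the class of the constant loop.
\<close>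

definition semilocally_simply_connected_at :: "'a::topological_space set \<Rightarrow> 'a \<Rightarrow> bool" where
  "semilocally_simply_connected_at X x \<longleftrightarrow>
     (\<exists>U. openin (top_of_set X) U \<and> x \<in> U \<and>
       (\<forall>\<gamma>\<in>paths_from U x. pathfinish \<gamma> = x \<longrightarrow>
          path_class X \<gamma> = path_class X (\<lambda>_. x)))"

definition wild_set :: "'a::topological_space set \<Rightarrow> 'a set" where
  "wild_set X = {x \<in> X. \<not> semilocally_simply_connected_at X x}"

definition path_space :: "'a::topological_space set \<Rightarrow> 'a \<Rightarrow> (real \<Rightarrow> 'a) set set" where
  "path_space X x0 = path_class X ` paths_from X x0"

definition path_nbhd ::
    "'a::topological_space set \<Rightarrow> (real \<Rightarrow> 'a) \<Rightarrow> 'a set \<Rightarrow> (real \<Rightarrow> 'a) set set" where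
  "path_nbhd X \<alpha> U = {path_class X (\<alpha> +++ \<gamma>) | \<gamma>. \<gamma> \<in> paths_from U (pathfinish \<alpha>)}"

definition path_space_topology ::
    "'a::topological_space set \<Rightarrow> 'a \<Rightarrow> (real \<Rightarrow> 'a) set topology" where
  "path_space_topology X x0 = topology_generated_by
     {path_nbhd X \<alpha> U | \<alpha> U.
        \<alpha> \<in> paths_from X x0 \<and> openin (top_of_set X) U \<and> pathfinish \<alpha> \<in> U}"

text \<open>
  The projection p. All paths in a class have the same endpoint, so the image below is a
  singleton.
\<close>

definition class_end :: "(real \<Rightarrow> 'a::topological_space) set \<Rightarrow> 'a" where
  "class_end c = the_elem (pathfinish ` c)"

definition fibre :: "'a::topological_space set \<Rightarrow> 'a \<Rightarrow> 'a \<Rightarrow> (real \<Rightarrow> 'a) set set" where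
  "fibre X x0 x = {c \<in> path_space X x0. class_end c = x}"

text \<open>
  The classes in the union below coincide whenever c lies in the fibre over the initial point of
  a path \<open>\<beta>\<close> in X, so that the value on the class of \<open>\<alpha>\<close> is the class of \<open>\<alpha> +++ \<beta>\<close>.
\<close>

definition monodromy ::
    "'a::topological_space set \<Rightarrow> (real \<Rightarrow> 'a) \<Rightarrow> (real \<Rightarrow> 'a) set \<Rightarrow> (real \<Rightarrow> 'a) set" where
  "monodromy X \<beta> c = (\<Union>\<alpha>\<in>c. path_class X (\<alpha> +++ \<beta>))"

definition monodromy_graph ::
    "'a::topological_space set \<Rightarrow> 'a \<Rightarrow> (real \<Rightarrow> 'a) \<Rightarrow>
      ((real \<Rightarrow> 'a) set \<times> (real \<Rightarrow> 'a) set) set" where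
  "monodromy_graph X x0 \<beta> = (\<lambda>c. (c, monodromy X \<beta> c)) ` fibre X x0 (pathstart \<beta>)"

text \<open>
  Fibres over points of a path-connected X are nonempty and fibres over distinct points are
  disjoint, so the first alternative below forces \<open>x = y\<close>.
\<close>

definition discrete_monodromy :: "'a::topological_space set \<Rightarrow> 'a \<Rightarrow> bool" where
  "discrete_monodromy X x0 \<longleftrightarrow>
     (\<forall>x\<in>X. \<forall>y\<in>X. \<forall>\<beta>\<in>paths_from X x. pathfinish \<beta> = y \<longrightarrow>
        (\<forall>c\<in>fibre X x0 x. monodromy X \<beta> c = c) \<or>
        subtopology (prod_topology (path_space_topology X x0) (path_space_topology X x0))
            (monodromy_graph X x0 \<beta>)
          = discrete_topology (monodromy_graph X x0 \<beta>))"

end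

theory Submission
  imports Defs
begin

text \<open>
  A homotopy from the identity to \<open>\<phi> = g \<circ> f\<close> moves a point x along a track \<open>\<beta>\<close>, and every loop
  \<open>\<gamma>\<close> at x satisfies \<open>\<gamma> \<cdot> \<beta> \<simeq> \<beta> \<cdot> (\<phi> \<circ> \<gamma>)\<close>. If \<open>f \<circ> \<gamma>\<close> is null-homotopic, then so is \<open>\<gamma>\<close>; hence f
  maps wild points to wild points. If x is wild, there are arbitrarily small essential
  loops \<open>\<gamma>\<close> at x, and their images \<open>\<phi> \<circ> \<gamma>\<close> are small too, so the points
  \<open>([\<alpha> \<cdot> \<gamma>], [\<alpha> \<cdot> \<gamma> \<cdot> \<beta>]) = ([\<alpha> \<cdot> \<gamma>], [\<alpha> \<cdot> \<beta> \<cdot> (\<phi> \<circ> \<gamma>)])\<close> of the monodromy graph accumulate at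
  \<open>([\<alpha>], [\<alpha> \<cdot> \<beta>])\<close>. The monodromy of \<open>\<beta>\<close> is therefore the identity, and \<open>\<phi>(x) = x\<close>.
\<close>

section \<open>Tracks of a homotopy and the squares they span\<close>

text \<open>The two sides are the images under \<open>F\<close> of the two boundary routes
  \<open>p\<close> and \<open>q\<close> from (0,0) to (1,1). The square is convex, hence simply
  connected, so the routes are already homotopic there and \<open>F\<close> carries the homotopy
  into \<open>X\<close>.\<close>

lemma homotopic_paths_square:
  fixes F :: "real \<times> real \<Rightarrow> 'a::topological_space"
  assumes "continuous_on ({0..1} \<times> {0..1}) F" "F ` ({0..1} \<times> {0..1}) \<subseteq> X"
  shows "homotopic_paths X ((\<lambda>t. F (0, t)) +++ (\<lambda>s. F (s, 1))) ((\<lambda>s. F (s, 0)) +++ (\<lambda>t. F (1, t)))"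
proof -
  define S where "S = {0..1::real} \<times> {0..1::real}"
  define p where "p = linepath (0::real, 0::real) (0, 1) +++ linepath (0, 1) (1, 1)"
  define q where "q = linepath (0::real, 0::real) (1, 0) +++ linepath (1, 0) (1, 1)"
  have "convex S"
    unfolding S_def by (intro convex_Times convex_real_interval)
  moreover have "path p" "path q" "pathstart p = pathstart q" "pathfinish p = pathfinish q"
    by (auto simp: p_def q_def)
  moreover have "path_image p \<subseteq> S" "path_image q \<subseteq> S"
    unfolding p_def q_def using \<open>convex S\<close>
    by (simp_all add: subset_path_image_join closed_segment_subset S_def)
  ultimately have "homotopic_paths S p q"
    using convex_imp_simply_connected[of S] by (simp add: simply_connected_eq_homotopic_paths)
  then have "homotopic_paths X (F \<circ> p) (F \<circ> q)"
    using assms by (intro homotopic_paths_continuous_image) (auto simp: S_def)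
  moreover have "F \<circ> p = (\<lambda>t. F (0, t)) +++ (\<lambda>s. F (s, 1))"
    unfolding p_def path_compose_join by (simp add: o_def linepath_def)
  moreover have "F \<circ> q = (\<lambda>s. F (s, 0)) +++ (\<lambda>t. F (1, t))"
    unfolding q_def path_compose_join by (simp add: o_def linepath_def)
  ultimately show ?thesis by simp
qed

text \<open>This is the square of \<open>F (s, t) = h (s, \<gamma> t)\<close>: horizontal edges are
  tracks of the end points of \<open>\<gamma>\<close>, vertical edges the images of
  \<open>\<gamma>\<close> under the two end maps.\<close>

lemma homotopic_paths_homotopy_tracks:
  fixes h :: "real \<times> 'a::topological_space \<Rightarrow> 'b::topological_space"
  assumes h: "continuous_map (prod_topology (top_of_set {0..1}) (top_of_set X)) (top_of_set Y) h"
    and \<gamma>: "path \<gamma>" "path_image \<gamma> \<subseteq> X"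
  shows "homotopic_paths Y ((\<lambda>t. h (0, \<gamma> t)) +++ (\<lambda>s. h (s, \<gamma> 1)))
            ((\<lambda>s. h (s, \<gamma> 0)) +++ (\<lambda>t. h (1, \<gamma> t)))"
proof -
  have h': "continuous_on ({0..1} \<times> X) h" "h ` ({0..1} \<times> X) \<subseteq> Y"
    using h by (auto)
  have \<gamma>c: "continuous_on {0..1} \<gamma>" and \<gamma>i: "\<And>t. t \<in> {0..1} \<Longrightarrow> \<gamma> t \<in> X"
    using \<gamma> by (auto simp: path_def path_image_def)
  define F where "F = (\<lambda>z. h (fst z, \<gamma> (snd z)))"
  have "continuous_on ({0..1} \<times> {0..1}) F"
    unfolding F_def
    by (rule continuous_on_compose2[OF h'(1)])
      (auto intro!: continuous_intros continuous_on_compose2[OF \<gamma>c] \<gamma>i)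
  moreover have "F ` ({0..1} \<times> {0..1}) \<subseteq> Y"
    using h'(2) \<gamma>i by (auto simp: F_def)
  ultimately show ?thesis
    using homotopic_paths_square[of F Y] by (simp add: F_def)
qed

text \<open>When \<open>\<gamma>\<close> is a loop at \<open>x\<close>, both track edges of the
  square are the same path \<open>\<beta>\<close>. That path depends only on \<open>x\<close>, so
  one \<open>\<beta>\<close> serves all loops; later proofs choose \<open>\<gamma>\<close> after
  \<open>\<beta>\<close>.\<close>

lemma homotopy_track_id:
  assumes "homotopic_with_canon (\<lambda>_. True) X X id \<phi>" and "x \<in> X"
  obtains \<beta> where "path \<beta>" "path_image \<beta> \<subseteq> X" "pathstart \<beta> = x" "pathfinish \<beta> = \<phi> x"
    and "\<And>\<gamma>. \<lbrakk>path \<gamma>; path_image \<gamma> \<subseteq> X; pathstart \<gamma> = x; pathfinish \<gamma> = x\<rbrakk> \<Longrightarrow>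
          homotopic_paths X (\<gamma> +++ \<beta>) (\<beta> +++ (\<phi> \<circ> \<gamma>))"
proof -
  obtain h :: "real \<times> 'a \<Rightarrow> 'a" where
    h: "continuous_map (prod_topology (top_of_set {0..1}) (top_of_set X)) (top_of_set X) h"
    and h01: "\<And>x. h (0, x) = x" "\<And>x. h (1, x) = \<phi> x"
    using assms(1) by (auto simp: homotopic_with_def)
  have h': "continuous_on ({0..1} \<times> X) h" "h ` ({0..1} \<times> X) \<subseteq> X"
    using h by (auto)
  show thesis
  proof (rule that[of "\<lambda>s. h (s, x)"])
    show "path (\<lambda>s. h (s, x))"
      unfolding path_def
      by (rule continuous_on_compose2[OF h'(1)]) (use assms(2) in \<open>auto intro!: continuous_intros\<close>)
    show "path_image (\<lambda>s. h (s, x)) \<subseteq> X"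
      using h'(2) assms(2) by (auto simp: path_image_def)
  next
    fix \<gamma> assume "path \<gamma>" "path_image \<gamma> \<subseteq> X" "pathstart \<gamma> = x" "pathfinish \<gamma> = x"
    then show "homotopic_paths X (\<gamma> +++ (\<lambda>s. h (s, x))) ((\<lambda>s. h (s, x)) +++ (\<phi> \<circ> \<gamma>))"
      using homotopic_paths_homotopy_tracks[OF h, of \<gamma>]
      by (simp add: h01 pathstart_def pathfinish_def o_def)
  qed (auto simp: pathstart_def pathfinish_def h01)
qed

section \<open>Cancellation of paths up to homotopy in an arbitrary space\<close>

text \<open>
  The library's unit and inverse laws are stated with \<^const>\<open>linepath\<close> and hence only for
  normed spaces; they are transported here along \<open>\<alpha>\<close> from the unit interval.
\<close>

lemma homotopic_paths_const_laws:
  fixes \<alpha> :: "real \<Rightarrow> 'a::topological_space"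
  assumes "path \<alpha>" "path_image \<alpha> \<subseteq> X"
  shows homotopic_paths_const_right: "homotopic_paths X (\<alpha> +++ (\<lambda>_. pathfinish \<alpha>)) \<alpha>"
    and homotopic_paths_const_left: "homotopic_paths X ((\<lambda>_. pathstart \<alpha>) +++ \<alpha>) \<alpha>"
    and homotopic_paths_reversepath_left:
      "homotopic_paths X (reversepath \<alpha> +++ \<alpha>) (\<lambda>_. pathfinish \<alpha>)"
proof -
  \<comment> \<open>\<open>i\<close> is the identity path of the unit interval, the universal case:
    \<open>\<alpha> \<circ> i = \<alpha>\<close>, so each law for \<open>i\<close> becomes the law
    for \<open>\<alpha>\<close>.\<close>
  define i where "i = (\<lambda>t::real. t)"
  have i: "path i" "path_image i \<subseteq> {0..1}" "pathstart i = 0" "pathfinish i = 1"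
    by (auto simp: i_def path_def path_image_def pathstart_def pathfinish_def)
  have transport: "homotopic_paths X (\<alpha> \<circ> p) (\<alpha> \<circ> q)" if "homotopic_paths {0..1} p q" for p q
    using homotopic_paths_continuous_image[OF that] assms
    by (auto simp: path_def path_image_def)
  have const: "\<alpha> \<circ> linepath 1 1 = (\<lambda>_. pathfinish \<alpha>)" "\<alpha> \<circ> linepath 0 0 = (\<lambda>_. pathstart \<alpha>)"
    and comp: "\<alpha> \<circ> i = \<alpha>" "\<alpha> \<circ> reversepath i = reversepath \<alpha>"
    by (auto simp: i_def linepath_refl pathfinish_def pathstart_def reversepath_def)
  show "homotopic_paths X (\<alpha> +++ (\<lambda>_. pathfinish \<alpha>)) \<alpha>"
    using transport[OF homotopic_paths_rid[OF i(1,2)]]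
    by (simp only: i(3,4) path_compose_join const comp)
  show "homotopic_paths X ((\<lambda>_. pathstart \<alpha>) +++ \<alpha>) \<alpha>"
    using transport[OF homotopic_paths_lid[OF i(1,2)]]
    by (simp only: i(3,4) path_compose_join const comp)
  show "homotopic_paths X (reversepath \<alpha> +++ \<alpha>) (\<lambda>_. pathfinish \<alpha>)"
    using transport[OF homotopic_paths_linv[OF i(1,2)]]
    by (simp only: i(3,4) path_compose_join const comp)
qed

text \<open>Multiply on the left by the reverse of \<open>\<alpha>\<close>: replace the constant
  path in front of \<open>\<gamma>\<close> by \<open>?r +++ \<alpha>\<close>, reassociate, and
  absorb \<open>\<gamma>\<close> into \<open>\<alpha>\<close>.\<close>

lemma homotopic_paths_cancel_left:
  assumes "path \<alpha>" "path_image \<alpha> \<subseteq> X" and "path \<gamma>" "path_image \<gamma> \<subseteq> X"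
    and "pathstart \<gamma> = pathfinish \<alpha>" and "homotopic_paths X (\<alpha> +++ \<gamma>) \<alpha>"
  shows "homotopic_paths X \<gamma> (\<lambda>_. pathstart \<gamma>)"
proof -
  let ?x = "pathfinish \<alpha>" and ?r = "reversepath \<alpha>"
  have fin: "pathfinish \<gamma> = pathfinish \<alpha>"
    using homotopic_paths_imp_pathfinish[OF assms(6)] by simp
  have r: "homotopic_paths X (?r +++ \<alpha>) (\<lambda>_. ?x)"
    using homotopic_paths_reversepath_left assms by blast
  have "homotopic_paths X \<gamma> ((\<lambda>_. ?x) +++ \<gamma>)"
    using homotopic_paths_const_left[of \<gamma> X] assms homotopic_paths_sym by metis
  also have "homotopic_paths X \<dots> ((?r +++ \<alpha>) +++ \<gamma>)"
    using assms by (intro homotopic_paths_join homotopic_paths_sym[OF r]) (auto simp: pathfinish_def)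
  also have "homotopic_paths X \<dots> (?r +++ (\<alpha> +++ \<gamma>))"
    using assms by (intro homotopic_paths_sym[OF homotopic_paths_assoc]) auto
  also have "homotopic_paths X \<dots> (?r +++ \<alpha>)"
    using assms by (intro homotopic_paths_join) auto
  also have "homotopic_paths X \<dots> (\<lambda>_. ?x)"
    by (fact r)
  finally show ?thesis
    using assms(5) by simp
qed

text \<open>Reversal exchanges the two factors and reduces this to left cancellation of
  \<open>reversepath \<beta>\<close>.\<close>

lemma homotopic_paths_cancel_right:
  assumes "path \<beta>" "path_image \<beta> \<subseteq> X" and "path \<gamma>" "path_image \<gamma> \<subseteq> X"
    and "pathfinish \<gamma> = pathstart \<beta>" and "homotopic_paths X (\<gamma> +++ \<beta>) \<beta>"
  shows "homotopic_paths X \<gamma> (\<lambda>_. pathstart \<gamma>)"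
proof -
  have st: "pathstart \<gamma> = pathstart \<beta>"
    using homotopic_paths_imp_pathstart[OF assms(6)] by simp
  have "homotopic_paths X (reversepath \<beta> +++ reversepath \<gamma>) (reversepath \<beta>)"
    using assms(5,6) homotopic_paths_reversepath[of X "\<gamma> +++ \<beta>" \<beta>]
    by (simp add: reversepath_joinpaths)
  then have "homotopic_paths X (reversepath \<gamma>) (\<lambda>_. pathstart (reversepath \<gamma>))"
    using assms st by (intro homotopic_paths_cancel_left[of "reversepath \<beta>"]) auto
  \<comment> \<open>Reversing back leaves the constant path at the end of \<open>\<gamma>\<close>;
    by \<open>st\<close> the path is a loop, so this is also its start.\<close>
  then have "homotopic_paths X (reversepath (reversepath \<gamma>)) (reversepath (\<lambda>_. pathfinish \<gamma>))"
    by (simp only: homotopic_paths_reversepath pathstart_reversepath)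
  then show ?thesis
    using st assms(5) by (simp add: reversepath_def)
qed

section \<open>Path classes and small essential loops\<close>

text \<open>Reflexivity holds only for paths in \<open>X\<close>; any other function has an empty
  class. The assumptions on \<open>\<alpha>\<close> put it in its own class, hence in the class of
  \<open>\<beta>\<close> when the two agree.\<close>

lemma path_class_eq_iff:
  assumes "path \<alpha>" "path_image \<alpha> \<subseteq> X"
  shows "path_class X \<alpha> = path_class X \<beta> \<longleftrightarrow> homotopic_paths X \<alpha> \<beta>"
  using assms homotopic_paths_refl homotopic_paths_sym homotopic_paths_trans
  unfolding path_class_def set_eq_iff mem_Collect_eq by metis

lemma paths_from_join:
  assumes "\<alpha> \<in> paths_from X x" "\<beta> \<in> paths_from X (pathfinish \<alpha>)"
  shows "\<alpha> +++ \<beta> \<in> paths_from X x"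
  using assms by (auto simp: paths_from_def path_image_join)

lemma wild_setE:
  assumes "x \<in> wild_set X" and "openin (top_of_set X) U" and "x \<in> U"
  obtains \<gamma> where "\<gamma> \<in> paths_from U x" "pathfinish \<gamma> = x" "\<not> homotopic_paths X \<gamma> (\<lambda>_. x)"
proof -
  obtain \<gamma> where \<gamma>: "\<gamma> \<in> paths_from U x" "pathfinish \<gamma> = x"
      "path_class X \<gamma> \<noteq> path_class X (\<lambda>_. x)"
    using assms unfolding wild_set_def semilocally_simply_connected_at_def by blast
  moreover have "path \<gamma>" "path_image \<gamma> \<subseteq> X"
    using \<gamma>(1) openin_imp_subset[OF assms(2)] by (auto simp: paths_from_def)
  ultimately show thesis
    using that path_class_eq_iff by metis
qed

section \<open>Preservation of wild points\<close>

text \<open>Since \<open>g \<circ> f\<close> is homotopic to the identity, \<open>f\<close> kills no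
  essential loop. A neighbourhood witnessing that \<open>f x\<close> is not wild would thus pull
  back to one at \<open>x\<close>.\<close>

lemma wild_set_image:
  assumes f: "continuous_map (top_of_set X) (top_of_set Y) f"
    and g: "continuous_map (top_of_set Y) (top_of_set X) g"
    and gf: "homotopic_with_canon (\<lambda>_. True) X X (g \<circ> f) id"
  shows "f ` wild_set X \<subseteq> wild_set Y"
proof (rule image_subsetI)
  fix x assume x: "x \<in> wild_set X"
  then have "x \<in> X" by (simp add: wild_set_def)
  have fc: "continuous_on X f" "f ` X \<subseteq> Y" and gc: "continuous_on Y g" "g ` Y \<subseteq> X"
    using f g by auto
  have "f x \<in> Y" using fc \<open>x \<in> X\<close> by auto
  show "f x \<in> wild_set Y"
  proof (rule ccontr)
    assume "f x \<notin> wild_set Y"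
    then obtain V where V: "openin (top_of_set Y) V" "f x \<in> V" and
      triv: "\<And>\<gamma>. \<lbrakk>\<gamma> \<in> paths_from V (f x); pathfinish \<gamma> = f x\<rbrakk> \<Longrightarrow>
                path_class Y \<gamma> = path_class Y (\<lambda>_. f x)"
      using \<open>f x \<in> Y\<close> unfolding wild_set_def semilocally_simply_connected_at_def by blast
    define U where "U = {z \<in> X. f z \<in> V}"
    have "openin (top_of_set X) U"
      using openin_continuous_map_preimage[OF f V(1)] by (simp add: U_def)
    moreover have "x \<in> U" using \<open>x \<in> X\<close> V by (simp add: U_def)
    ultimately obtain \<gamma> where \<gamma>U: "\<gamma> \<in> paths_from U x" and \<gamma>1: "pathfinish \<gamma> = x"
      and ess: "\<not> homotopic_paths X \<gamma> (\<lambda>_. x)"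
      using wild_setE[OF x] by metis
    have \<gamma>: "path \<gamma>" "path_image \<gamma> \<subseteq> X" "pathstart \<gamma> = x"
      using \<gamma>U by (auto simp: paths_from_def U_def)
    have pf: "path (f \<circ> \<gamma>)"
      using \<gamma> fc by (meson continuous_on_subset path_continuous_image)
    have fV: "f \<circ> \<gamma> \<in> paths_from V (f x)" "pathfinish (f \<circ> \<gamma>) = f x"
      using pf \<gamma>U \<gamma>1
      by (auto simp: paths_from_def U_def path_image_compose pathstart_compose pathfinish_compose)
    moreover have "path_image (f \<circ> \<gamma>) \<subseteq> Y"
      using \<gamma> fc by (auto simp: path_image_compose)
    ultimately have "homotopic_paths Y (f \<circ> \<gamma>) (\<lambda>_. f x)"
      using triv[OF fV] path_class_eq_iff[OF pf] by blast
    then have null: "homotopic_paths X (g \<circ> f \<circ> \<gamma>) (\<lambda>_. (g \<circ> f) x)"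
      using homotopic_paths_continuous_image[OF _ gc(1), of "f \<circ> \<gamma>" "\<lambda>_. f x" X] gc(2)
      by (auto simp: o_def)
    obtain \<beta> where \<beta>: "path \<beta>" "path_image \<beta> \<subseteq> X" "pathstart \<beta> = x" "pathfinish \<beta> = (g \<circ> f) x"
      and nat: "homotopic_paths X (\<gamma> +++ \<beta>) (\<beta> +++ (g \<circ> f \<circ> \<gamma>))"
      using homotopy_track_id[OF homotopic_with_symD[OF gf] \<open>x \<in> X\<close>] \<gamma> \<gamma>1 by metis
    \<comment> \<open>The chain \<open>\<gamma> +++ \<beta>\<close>,
      \<open>\<beta> +++ (g \<circ> f \<circ> \<gamma>)\<close>, \<open>\<beta>\<close> of homotopic
      paths lets \<open>\<beta>\<close> be cancelled, which contradicts the choice of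
      \<open>\<gamma>\<close> as essential.\<close>
    note nat
    also have "homotopic_paths X (\<beta> +++ (g \<circ> f \<circ> \<gamma>)) (\<beta> +++ (\<lambda>_. (g \<circ> f) x))"
      using null \<beta> \<gamma> by (intro homotopic_paths_join) (auto simp: pathstart_compose)
    also have "homotopic_paths X \<dots> \<beta>"
      using homotopic_paths_const_right[of \<beta> X] \<beta> by simp
    finally have "homotopic_paths X \<gamma> (\<lambda>_. pathstart \<gamma>)"
      using \<beta> \<gamma> \<gamma>1 by (intro homotopic_paths_cancel_right[of \<beta>]) auto
    with ess \<gamma>(3) show False by simp
  qed
qed

section \<open>Local bases of the path space\<close>

lemma path_nbhd_mono: "U \<subseteq> V \<Longrightarrow> path_nbhd X \<alpha> U \<subseteq> path_nbhd X \<alpha> V"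
  unfolding path_nbhd_def paths_from_def by blast

text \<open>A basic set can be recentred at each of its points: if \<open>\<delta>\<close> is
  homotopic to \<open>\<alpha> +++ \<gamma>\<close>, then \<open>\<delta> +++ \<epsilon>\<close> is
  homotopic to \<open>\<alpha> +++ (\<gamma> +++ \<epsilon>)\<close>, and
  \<open>\<gamma> +++ \<epsilon>\<close> still runs in \<open>U\<close>.\<close>

lemma path_nbhd_rebase:
  assumes \<alpha>: "\<alpha> \<in> paths_from X x0" and "U \<subseteq> X" and \<delta>: "\<delta> \<in> paths_from X x0"
    and mem: "path_class X \<delta> \<in> path_nbhd X \<alpha> U"
  shows "pathfinish \<delta> \<in> U" "path_nbhd X \<delta> U \<subseteq> path_nbhd X \<alpha> U"
proof -
  obtain \<gamma> where \<gamma>: "\<gamma> \<in> paths_from U (pathfinish \<alpha>)"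
    and eq: "path_class X \<delta> = path_class X (\<alpha> +++ \<gamma>)"
    using mem by (auto simp: path_nbhd_def)
  have hom: "homotopic_paths X \<delta> (\<alpha> +++ \<gamma>)"
    using eq \<delta> path_class_eq_iff by (auto simp: paths_from_def)
  then have fin: "pathfinish \<delta> = pathfinish \<gamma>"
    using homotopic_paths_imp_pathfinish by fastforce
  then show "pathfinish \<delta> \<in> U"
    using \<gamma> pathfinish_in_path_image by (fastforce simp: paths_from_def)
  show "path_nbhd X \<delta> U \<subseteq> path_nbhd X \<alpha> U"
  proof
    fix c assume "c \<in> path_nbhd X \<delta> U"
    then obtain \<epsilon> where \<epsilon>: "\<epsilon> \<in> paths_from U (pathfinish \<delta>)" and c: "c = path_class X (\<delta> +++ \<epsilon>)"
      by (auto simp: path_nbhd_def)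
    have p: "path \<alpha>" "path_image \<alpha> \<subseteq> X" "path \<gamma>" "path_image \<gamma> \<subseteq> X" "path \<epsilon>" "path_image \<epsilon> \<subseteq> X"
      "pathstart \<gamma> = pathfinish \<alpha>" "pathstart \<epsilon> = pathfinish \<gamma>"
      using \<alpha> \<gamma> \<epsilon> fin \<open>U \<subseteq> X\<close> by (auto simp: paths_from_def)
    have "homotopic_paths X (\<delta> +++ \<epsilon>) ((\<alpha> +++ \<gamma>) +++ \<epsilon>)"
      using hom p fin by (intro homotopic_paths_join) auto
    also have "homotopic_paths X \<dots> (\<alpha> +++ (\<gamma> +++ \<epsilon>))"
      using p by (intro homotopic_paths_sym[OF homotopic_paths_assoc]) auto
    finally have "c = path_class X (\<alpha> +++ (\<gamma> +++ \<epsilon>))"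
      using c path_class_eq_iff homotopic_paths_imp_path homotopic_paths_imp_subset by metis
    moreover have "\<gamma> +++ \<epsilon> \<in> paths_from U (pathfinish \<alpha>)"
      using \<gamma> \<epsilon> fin paths_from_join by metis
    ultimately show "c \<in> path_nbhd X \<alpha> U"
      unfolding path_nbhd_def by blast
  qed
qed

text \<open>The topology is only given by generators, which may be centred elsewhere. Induction over
  the generation of \<open>A\<close> yields neighbourhoods centred at \<open>\<delta>\<close>
  itself: recentring settles generators, and \<open>U \<inter> V\<close> settles
  intersections.\<close>

lemma path_space_topology_base:
  assumes "openin (path_space_topology X x0) A" and "path_class X \<delta> \<in> A"
    and \<delta>: "\<delta> \<in> paths_from X x0"
  obtains U where "openin (top_of_set X) U" "pathfinish \<delta> \<in> U" "path_nbhd X \<delta> U \<subseteq> A"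
proof -
  let ?B = "{path_nbhd X \<alpha> U | \<alpha> U.
        \<alpha> \<in> paths_from X x0 \<and> openin (top_of_set X) U \<and> pathfinish \<alpha> \<in> U}"
  have "generate_topology_on ?B A"
    using assms(1) by (simp add: path_space_topology_def openin_topology_generated_by_iff)
  \<comment> \<open>Membership stays inside the induction formula, since it must pass to the parts
    of an intersection or union.\<close>
  then have "path_class X \<delta> \<in> A \<longrightarrow>
      (\<exists>U. openin (top_of_set X) U \<and> pathfinish \<delta> \<in> U \<and> path_nbhd X \<delta> U \<subseteq> A)"
  proof induction
    case Empty
    show ?case by simp
  next
    case (Int a b)
    show ?case
    proof
      assume "path_class X \<delta> \<in> a \<inter> b"
      then obtain U V where UV: "openin (top_of_set X) U" "pathfinish \<delta> \<in> U" "path_nbhd X \<delta> U \<subseteq> a"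
        "openin (top_of_set X) V" "pathfinish \<delta> \<in> V" "path_nbhd X \<delta> V \<subseteq> b"
        using Int.IH by blast
      then show "\<exists>U. openin (top_of_set X) U \<and> pathfinish \<delta> \<in> U \<and> path_nbhd X \<delta> U \<subseteq> a \<inter> b"
        using path_nbhd_mono[of "U \<inter> V" U X \<delta>] path_nbhd_mono[of "U \<inter> V" V X \<delta>]
        by (intro exI[of _ "U \<inter> V"]) auto
    qed
  next
    case (UN K)
    show ?case
    proof
      assume "path_class X \<delta> \<in> \<Union>K"
      then obtain k where k: "k \<in> K" "path_class X \<delta> \<in> k" by blast
      with UN.IH[of k] show "\<exists>U. openin (top_of_set X) U \<and> pathfinish \<delta> \<in> U \<and> path_nbhd X \<delta> U \<subseteq> \<Union>K"
        by (meson Union_upper order_trans)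
    qed
  next
    case (Basis s)
    then obtain \<alpha> U where s: "s = path_nbhd X \<alpha> U" "\<alpha> \<in> paths_from X x0" "openin (top_of_set X) U"
      by blast
    then show ?case
      using path_nbhd_rebase[OF s(2) openin_imp_subset[OF s(3)] \<delta>] by auto
  qed
  with assms(2) that show thesis by blast
qed

section \<open>End points and monodromy in terms of representatives\<close>

lemma class_end_path_class:
  assumes "path \<alpha>" "path_image \<alpha> \<subseteq> X"
  shows "class_end (path_class X \<alpha>) = pathfinish \<alpha>"
proof -
  have "pathfinish ` path_class X \<alpha> = {pathfinish \<alpha>}"
    using assms homotopic_paths_imp_pathfinish[of X \<alpha>] homotopic_paths_refl[of X \<alpha>]
    by (fastforce simp: path_class_def)
  then show ?thesis by (simp add: class_end_def)
qed

lemma monodromy_path_class: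
  assumes "path \<alpha>" "path_image \<alpha> \<subseteq> X" and "path \<beta>" "path_image \<beta> \<subseteq> X"
    and "pathstart \<beta> = pathfinish \<alpha>"
  shows "monodromy X \<beta> (path_class X \<alpha>) = path_class X (\<alpha> +++ \<beta>)"
proof -
  have "path_class X (\<alpha>' +++ \<beta>) = path_class X (\<alpha> +++ \<beta>)" if "\<alpha>' \<in> path_class X \<alpha>" for \<alpha>'
  proof -
    have "homotopic_paths X (\<alpha> +++ \<beta>) (\<alpha>' +++ \<beta>)"
      using that assms by (intro homotopic_paths_join) (auto simp: path_class_def)
    then show ?thesis
      using path_class_eq_iff homotopic_paths_imp_path homotopic_paths_imp_subset by metis
  qed
  moreover have "\<alpha> \<in> path_class X \<alpha>"
    using assms by (simp add: path_class_def)
  ultimately show ?thesis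
    unfolding monodromy_def by blast
qed

section \<open>Rigidity of wild points under discrete monodromy\<close>

text \<open>Stated for any self-map \<open>\<phi>\<close> homotopic to the identity, so that it
  covers \<open>g \<circ> f\<close> on one space and \<open>f \<circ> g\<close> on the
  other.\<close>

lemma discrete_monodromy_fixes_wild_set:
  assumes "path_connected X" and "x0 \<in> X" and dm: "discrete_monodromy X x0"
    and \<phi>: "homotopic_with_canon (\<lambda>_. True) X X id \<phi>" and x: "x \<in> wild_set X"
  shows "\<phi> x = x"
proof (rule ccontr)
  assume neq: "\<phi> x \<noteq> x"
  have "x \<in> X" using x by (simp add: wild_set_def)
  have \<phi>m: "continuous_map (top_of_set X) (top_of_set X) \<phi>"
    using homotopic_with_imp_continuous_maps[OF \<phi>] by blast
  then have \<phi>c: "continuous_on X \<phi>" "\<phi> ` X \<subseteq> X"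
    by auto
  obtain \<beta> where \<beta>: "path \<beta>" "path_image \<beta> \<subseteq> X" "pathstart \<beta> = x" "pathfinish \<beta> = \<phi> x"
    and nat: "\<And>\<gamma>. \<lbrakk>path \<gamma>; path_image \<gamma> \<subseteq> X; pathstart \<gamma> = x; pathfinish \<gamma> = x\<rbrakk> \<Longrightarrow>
          homotopic_paths X (\<gamma> +++ \<beta>) (\<beta> +++ (\<phi> \<circ> \<gamma>))"
    using homotopy_track_id[OF \<phi> \<open>x \<in> X\<close>] by blast
  have mono: "monodromy X \<beta> (path_class X \<delta>) = path_class X (\<delta> +++ \<beta>)"
      "path_class X \<delta> \<in> fibre X x0 x"
    if "\<delta> \<in> paths_from X x0" "pathfinish \<delta> = x" for \<delta>
    using that \<beta> monodromy_path_class[of \<delta> X \<beta>] class_end_path_class[of \<delta> X]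
    by (auto simp: paths_from_def fibre_def path_space_def)
  obtain \<alpha> where \<alpha>: "\<alpha> \<in> paths_from X x0" "pathfinish \<alpha> = x"
    using assms(1,2) \<open>x \<in> X\<close> unfolding path_connected_def paths_from_def by blast
  have \<alpha>': "path \<alpha>" "path_image \<alpha> \<subseteq> X" "pathstart \<alpha> = x0"
    using \<alpha> by (auto simp: paths_from_def)
  have \<alpha>\<beta>: "\<alpha> +++ \<beta> \<in> paths_from X x0"
    using \<alpha> \<beta> by (intro paths_from_join) (auto simp: paths_from_def)
  let ?T = "path_space_topology X x0" and ?G = "monodromy_graph X x0 \<beta>"
  let ?a = "path_class X \<alpha>" and ?b = "path_class X (\<alpha> +++ \<beta>)"
  \<comment> \<open>These classes end at \<open>x\<close> and \<open>\<phi> x\<close>, assumed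
    distinct. This excludes the identity alternative and leaves a discrete graph.\<close>
  have "?a \<noteq> ?b"
    using path_class_eq_iff[OF \<alpha>'(1,2)] homotopic_paths_imp_pathfinish[of X \<alpha> "\<alpha> +++ \<beta>"] \<alpha>(2) \<beta>(4) neq
    by auto
  then have "\<not> (\<forall>c\<in>fibre X x0 x. monodromy X \<beta> c = c)"
    using mono[OF \<alpha>] by metis
  moreover have "\<beta> \<in> paths_from X x" "\<phi> x \<in> X"
    using \<beta> \<phi>c \<open>x \<in> X\<close> by (auto simp: paths_from_def)
  ultimately have disc: "subtopology (prod_topology ?T ?T) ?G = discrete_topology ?G"
    using dm \<open>x \<in> X\<close> \<beta>(4) unfolding discrete_monodromy_def by blast
  have inG: "(path_class X \<delta>, path_class X (\<delta> +++ \<beta>)) \<in> ?G"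
    if "\<delta> \<in> paths_from X x0" "pathfinish \<delta> = x" for \<delta>
    unfolding monodromy_graph_def using mono[OF that] \<beta>(3)
    by (intro image_eqI[of _ _ "path_class X \<delta>"]) auto
  \<comment> \<open>Discreteness isolates \<open>(?a, ?b)\<close> in the graph; the open box
    \<open>A \<times> B\<close> found below meets the graph in this point only.\<close>
  have "openin (subtopology (prod_topology ?T ?T) ?G) {(?a, ?b)}"
    unfolding disc using inG[OF \<alpha>] by simp
  then obtain W where W: "openin (prod_topology ?T ?T) W" "W \<inter> ?G = {(?a, ?b)}"
    unfolding openin_subtopology by metis
  then have "(?a, ?b) \<in> W" by blast
  with W(1) obtain A B where AB: "openin ?T A" "openin ?T B" "?a \<in> A" "?b \<in> B" "A \<times> B \<subseteq> W"
    unfolding openin_prod_topology_alt by metis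
  obtain U where U: "openin (top_of_set X) U" "x \<in> U" "path_nbhd X \<alpha> U \<subseteq> A"
    using path_space_topology_base[OF AB(1,3) \<alpha>(1)] \<alpha>(2) by metis
  obtain V where V: "openin (top_of_set X) V" "\<phi> x \<in> V" "path_nbhd X (\<alpha> +++ \<beta>) V \<subseteq> B"
    using path_space_topology_base[OF AB(2,4) \<alpha>\<beta>] \<beta>(4) by auto
  \<comment> \<open>A loop in \<open>N\<close> stays in \<open>U\<close> while its image under
    \<open>\<phi>\<close> stays in \<open>V\<close>, so both coordinates of the new graph point are
    controlled at once.\<close>
  define N where "N = U \<inter> {z \<in> X. \<phi> z \<in> V}"
  have "openin (top_of_set X) N"
    using openin_continuous_map_preimage[OF \<phi>m V(1)] U(1) by (simp add: N_def openin_Int)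
  moreover have "x \<in> N"
    using U V \<open>x \<in> X\<close> by (simp add: N_def)
  ultimately obtain \<gamma> where \<gamma>N: "\<gamma> \<in> paths_from N x" and \<gamma>1: "pathfinish \<gamma> = x"
    and ess: "\<not> homotopic_paths X \<gamma> (\<lambda>_. x)"
    using wild_setE[OF x] by metis
  have \<gamma>: "path \<gamma>" "path_image \<gamma> \<subseteq> X" "pathstart \<gamma> = x"
    using \<gamma>N by (auto simp: paths_from_def N_def)
  have \<phi>\<gamma>: "path (\<phi> \<circ> \<gamma>)" "path_image (\<phi> \<circ> \<gamma>) \<subseteq> X"
    using \<gamma> \<phi>c by (auto simp: path_image_compose intro: path_continuous_image continuous_on_subset)
  have \<alpha>\<gamma>: "\<alpha> +++ \<gamma> \<in> paths_from X x0" "pathfinish (\<alpha> +++ \<gamma>) = x"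
    using \<alpha> \<gamma> \<gamma>1 by (auto simp: paths_from_def path_image_join)
  have "\<gamma> \<in> paths_from U (pathfinish \<alpha>)"
    using \<gamma>N \<alpha>(2) by (auto simp: paths_from_def N_def)
  then have inA: "path_class X (\<alpha> +++ \<gamma>) \<in> A"
    using U(3) unfolding path_nbhd_def by blast
  \<comment> \<open>Moving \<open>\<gamma>\<close> past \<open>\<beta>\<close> turns it into
    \<open>\<phi> \<circ> \<gamma>\<close> at the far end, which displays the second coordinate as a
    point of the basic set of \<open>\<alpha> +++ \<beta>\<close> and \<open>V\<close>.\<close>
  have "homotopic_paths X ((\<alpha> +++ \<gamma>) +++ \<beta>) (\<alpha> +++ (\<gamma> +++ \<beta>))"
    using \<alpha>' \<alpha>(2) \<beta> \<gamma> \<gamma>1 by (intro homotopic_paths_sym[OF homotopic_paths_assoc]) auto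
  also have "homotopic_paths X \<dots> (\<alpha> +++ (\<beta> +++ (\<phi> \<circ> \<gamma>)))"
    using \<alpha>' \<alpha>(2) \<gamma>(3) by (intro homotopic_paths_join[OF _ nat[OF \<gamma> \<gamma>1]]) auto
  also have "homotopic_paths X \<dots> ((\<alpha> +++ \<beta>) +++ (\<phi> \<circ> \<gamma>))"
    using homotopic_paths_assoc[of \<alpha> X \<beta> "\<phi> \<circ> \<gamma>"] \<alpha>' \<alpha>(2) \<beta> \<phi>\<gamma> \<gamma>(3)
    by (simp add: pathstart_compose)
  finally have "path_class X ((\<alpha> +++ \<gamma>) +++ \<beta>) = path_class X ((\<alpha> +++ \<beta>) +++ (\<phi> \<circ> \<gamma>))"
    using path_class_eq_iff homotopic_paths_imp_path homotopic_paths_imp_subset by metis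
  moreover have "\<phi> \<circ> \<gamma> \<in> paths_from V (pathfinish (\<alpha> +++ \<beta>))"
    using \<phi>\<gamma> \<gamma>N \<beta>(4)
    by (auto simp: paths_from_def N_def path_image_compose pathstart_compose)
  ultimately have inB: "path_class X ((\<alpha> +++ \<gamma>) +++ \<beta>) \<in> B"
    using V(3) unfolding path_nbhd_def by blast
  \<comment> \<open>The graph point of \<open>\<alpha> +++ \<gamma>\<close> lies in the box, so it
    is \<open>(?a, ?b)\<close>. Its first coordinate lets \<open>\<alpha>\<close> be cancelled,
    making \<open>\<gamma>\<close> null-homotopic.\<close>
  have "path_class X (\<alpha> +++ \<gamma>) = ?a"
    using inA inB AB(5) W(2) inG[OF \<alpha>\<gamma>] by blast
  then have "homotopic_paths X (\<alpha> +++ \<gamma>) \<alpha>"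
    using \<alpha>\<gamma>(1) path_class_eq_iff by (auto simp: paths_from_def)
  then have "homotopic_paths X \<gamma> (\<lambda>_. pathstart \<gamma>)"
    using \<alpha>' \<alpha>(2) \<gamma> by (intro homotopic_paths_cancel_left[of \<alpha>]) auto
  with ess \<gamma>(3) show False by simp
qed

theorem theorem9p15:
  fixes X :: "'a::topological_space set" and Y :: "'b::topological_space set"
    and x0 :: 'a and y0 :: 'b
    and f :: "'a \<Rightarrow> 'b" and g :: "'b \<Rightarrow> 'a"
  assumes "path_connected X" and "x0 \<in> X" and "discrete_monodromy X x0"
    and "path_connected Y" and "y0 \<in> Y" and "discrete_monodromy Y y0"
    and "continuous_map (top_of_set X) (top_of_set Y) f"
    and "continuous_map (top_of_set Y) (top_of_set X) g"
    and "homotopic_with_canon (\<lambda>_. True) X X (g \<circ> f) id"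
    and "homotopic_with_canon (\<lambda>_. True) Y Y (f \<circ> g) id"
  shows "homeomorphism (wild_set X) (wild_set Y) f g"
proof (rule homeomorphismI)
  have sub: "wild_set X \<subseteq> X" "wild_set Y \<subseteq> Y"
    by (auto simp: wild_set_def)
  show "continuous_on (wild_set X) f" "continuous_on (wild_set Y) g"
    using assms(7,8) sub by (auto intro: continuous_on_subset)
  show "f ` wild_set X \<subseteq> wild_set Y"
    using wild_set_image[OF assms(7,8,9)] .
  show "g ` wild_set Y \<subseteq> wild_set X"
    using wild_set_image[OF assms(8,7,10)] .
  \<comment> \<open>The given homotopies end at the identity, whereas the rigidity lemma starts
    there; hence the symmetry.\<close>
  show "g (f x) = x" if "x \<in> wild_set X" for x
    using discrete_monodromy_fixes_wild_set[OF assms(1-3) homotopic_with_symD[OF assms(9)] that]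
    by simp
  show "f (g y) = y" if "y \<in> wild_set Y" for y
    using discrete_monodromy_fixes_wild_set[OF assms(4-6) homotopic_with_symD[OF assms(10)] that]
    by simp
qed

end
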